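(* Let $d\ge1$ be an integer and let $(X_t)_{t\ge0}$ be a discrete-time simple symmetric random walk on $\mathbb{Z}^d$ with $X_0=0$. There exists a constant $c>0$ (depending only on $d$) such that, for all integers $t\ge1$ and $n\ge1$ and all subgraphs $H$ of $\mathbb{Z}^d$ with $|H|=n$, \[ \mathbb{P}(\mathfrak{t}_H>t)\ \le\ \sqrt{n}\,\exp\left(-c\,t\,n^{-\frac{2}{d}}\right), \] where $\mathfrak{t}_H=\inf\{s\ge0: X_s\notin H\}$ is the exit time of $H$ by $X$.
   Context: $\mathbb{Z}^d$ is regarded as a graph with nearest-neighbor edges; simple symmetric random walk moves at each integer time to one of the $2d$ nearest neighbors with probability $1/(2d)$ each. A subgraph $H$ is identified with its vertex set: $|H|$ denotes its number of vertices, and $X_s\notin H$ means that $X_s$ is not a vertex of $H$. $\mathbb{P}$ is the law of the random walk. *)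

theory Defs
  imports "HOL-Probability.Probability"
begin

text \<open>
  Points of \<open>\<int>\<^sup>d\<close> are vectors of type \<open>int ^ 'd\<close> with \<open>d = CARD('d) \<ge> 1\<close>. The steps of the walk are
  the \<open>2d\<close> nearest neighbours of the origin.
\<close>

definition unit_steps :: "(int ^ 'd) set" where
  "unit_steps = (\<Union>i. {axis i 1, axis i (- 1)})"

lemma finite_unit_steps: "finite (unit_steps :: (int ^ 'd) set)"
  by (simp add: unit_steps_def)

lemma unit_steps_nonempty: "unit_steps \<noteq> ({} :: (int ^ 'd) set)"
  by (simp add: unit_steps_def)

lemma card_unit_steps: "card (unit_steps :: (int ^ 'd) set) = 2 * CARD('d)"
proof -
  have ne: "axis i (1 :: int) \<noteq> axis j (- 1)" for i j :: 'd
    by (simp add: axis_eq_axis)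
  have "card (unit_steps :: (int ^ 'd) set) = (\<Sum>i\<in>(UNIV :: 'd set). card {axis i (1 :: int), axis i (- 1)})"
    unfolding unit_steps_def
    by (rule card_UN_disjoint) (auto simp: axis_eq_axis)
  also have "\<dots> = (\<Sum>i\<in>(UNIV :: 'd set). 2)"
    using ne by (intro sum.cong) auto
  finally show ?thesis by simp
qed

definition step_pmf :: "(int ^ 'd) pmf" where
  "step_pmf = pmf_of_set unit_steps"

text \<open>
  \<open>X\<close> is a simple symmetric random walk started at the origin, on an arbitrary probability space.
\<close>

definition simple_random_walk :: "'a measure \<Rightarrow> (nat \<Rightarrow> 'a \<Rightarrow> int ^ 'd) \<Rightarrow> bool" where
  "simple_random_walk M X \<longleftrightarrow>
     prob_space M \<and>
     (\<forall>t. X t \<in> M \<rightarrow>\<^sub>M count_space UNIV) \<and>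
     (AE \<omega> in M. X 0 \<omega> = 0) \<and>
     prob_space.indep_vars M (\<lambda>_. count_space UNIV) (\<lambda>t \<omega>. X (Suc t) \<omega> - X t \<omega>) UNIV \<and>
     (\<forall>t. distr M (count_space UNIV) (\<lambda>\<omega>. X (Suc t) \<omega> - X t \<omega>) = measure_pmf step_pmf)"

text \<open>
  The canonical realisation: the sample space consists of the sequences of steps, which are
  independent and uniform on \<^const>\<open>unit_steps\<close>. By \<open>simple_random_walk_prob_exit_time\<close> below,
  the exit times of every simple random walk have the distribution of those of the canonical one.
\<close>

definition walk_space :: "(nat \<Rightarrow> int ^ 'd) measure" where
  "walk_space = (\<Pi>\<^sub>M _\<in>UNIV. measure_pmf step_pmf)"

definition walk :: "nat \<Rightarrow> (nat \<Rightarrow> int ^ 'd) \<Rightarrow> int ^ 'd" where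
  "walk t \<omega> = (\<Sum>s<t. \<omega> s)"

text \<open>The infimum over the empty set is \<open>\<infinity>\<close>: the walk may never leave \<open>H\<close>.\<close>

definition exit_time :: "(nat \<Rightarrow> 'a \<Rightarrow> 'b) \<Rightarrow> 'b set \<Rightarrow> 'a \<Rightarrow> enat" where
  "exit_time X H \<omega> = Inf {enat s | s. X s \<omega> \<notin> H}"

lemma exit_time_gt_iff: "exit_time X H \<omega> > enat t \<longleftrightarrow> (\<forall>s\<le>t. X s \<omega> \<in> H)"
proof -
  have "exit_time X H \<omega> \<le> enat t \<longleftrightarrow> (\<exists>s\<le>t. X s \<omega> \<notin> H)"
  proof
    assume le: "exit_time X H \<omega> \<le> enat t"
    have "{enat s | s. X s \<omega> \<notin> H} \<noteq> {}"
      using le by (auto simp: exit_time_def Inf_enat_def simp del: Collect_empty_eq split: if_splits)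
    then have "exit_time X H \<omega> \<in> {enat s | s. X s \<omega> \<notin> H}"
      unfolding exit_time_def Inf_enat_def by (auto intro: LeastI)
    then show "\<exists>s\<le>t. X s \<omega> \<notin> H" using le by auto
  next
    assume "\<exists>s\<le>t. X s \<omega> \<notin> H"
    then obtain s where s: "s \<le> t" "X s \<omega> \<notin> H" by blast
    then have "exit_time X H \<omega> \<le> enat s"
      unfolding exit_time_def by (intro Inf_lower) auto
    also have "\<dots> \<le> enat t" using s by simp
    finally show "exit_time X H \<omega> \<le> enat t" .
  qed
  then show ?thesis by (metis not_le)
qed

lemma sets_exit_time_gt:
  assumes "\<And>s. X s \<in> M \<rightarrow>\<^sub>M count_space UNIV"
  shows "{\<omega> \<in> space M. exit_time X H \<omega> > enat t} \<in> sets M"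
proof -
  have "Measurable.pred M (\<lambda>\<omega>. X s \<omega> \<in> H)" for s
    by (rule measurable_compose[OF assms]) simp
  then have "Measurable.pred M (\<lambda>\<omega>. \<forall>s\<in>{..t}. X s \<omega> \<in> H)"
    by (intro pred_intros_finite) auto
  then have "{\<omega> \<in> space M. \<forall>s\<in>{..t}. X s \<omega> \<in> H} \<in> sets M"
    by (rule predE)
  then show ?thesis
    by (simp only: exit_time_gt_iff Ball_def atMost_iff)
qed

lemma measurable_vec_add:
  fixes f g :: "'a \<Rightarrow> int ^ 'd"
  assumes f: "f \<in> M \<rightarrow>\<^sub>M count_space UNIV" and g: "g \<in> M \<rightarrow>\<^sub>M count_space UNIV"
  shows "(\<lambda>x. f x + g x) \<in> M \<rightarrow>\<^sub>M count_space UNIV"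
proof (rule measurable_compose_countable[OF _ f])
  show "(\<lambda>x. v + g x) \<in> M \<rightarrow>\<^sub>M count_space UNIV" for v
    by (rule measurable_compose[OF g]) simp
qed

lemma measurable_vec_diff:
  fixes f g :: "'a \<Rightarrow> int ^ 'd"
  assumes f: "f \<in> M \<rightarrow>\<^sub>M count_space UNIV" and g: "g \<in> M \<rightarrow>\<^sub>M count_space UNIV"
  shows "(\<lambda>x. f x - g x) \<in> M \<rightarrow>\<^sub>M count_space UNIV"
proof (rule measurable_compose_countable[OF _ f])
  show "(\<lambda>x. v - g x) \<in> M \<rightarrow>\<^sub>M count_space UNIV" for v
    by (rule measurable_compose[OF g]) simp
qed

lemma sets_walk_space:
  "sets (walk_space :: (nat \<Rightarrow> int ^ 'd) measure) = sets (\<Pi>\<^sub>M _\<in>UNIV. count_space UNIV)"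
  unfolding walk_space_def by (intro sets_PiM_cong) auto

lemma space_walk_space: "space walk_space = UNIV"
  by (simp add: walk_space_def space_PiM)

lemma prob_space_walk_space: "prob_space walk_space"
  unfolding walk_space_def by (intro prob_space_PiM prob_space_measure_pmf)

lemma measurable_step: "(\<lambda>\<omega>. \<omega> s) \<in> walk_space \<rightarrow>\<^sub>M count_space UNIV"
proof -
  have "(\<lambda>\<omega>. \<omega> s) \<in> (\<Pi>\<^sub>M _\<in>(UNIV :: nat set). count_space UNIV) \<rightarrow>\<^sub>M count_space UNIV"
    by (rule measurable_component_singleton) simp
  then show ?thesis
    using measurable_cong_sets[OF sets_walk_space refl] by blast
qed

lemma measurable_walk: "(walk t :: _ \<Rightarrow> int ^ 'd) \<in> walk_space \<rightarrow>\<^sub>M count_space UNIV"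
proof (induction t)
  case 0
  show ?case by (simp add: walk_def[abs_def])
next
  case (Suc t)
  have "walk (Suc t) = (\<lambda>\<omega> :: nat \<Rightarrow> int ^ 'd. walk t \<omega> + \<omega> t)"
    by (simp add: walk_def fun_eq_iff)
  then show ?case
    using measurable_vec_add[OF Suc.IH measurable_step[of t]] by simp
qed

lemma simple_random_walk_walk: "simple_random_walk walk_space walk"
proof -
  interpret prob_space walk_space by (rule prob_space_walk_space)
  have incr: "(\<lambda>\<omega>. walk (Suc t) \<omega> - walk t \<omega>) = (\<lambda>\<omega>. \<omega> t)" for t
    by (simp add: walk_def fun_eq_iff)
  have distr: "distr walk_space (count_space UNIV) (\<lambda>\<omega>. \<omega> t) = measure_pmf step_pmf" for t
  proof -
    have "distr walk_space (count_space UNIV) (\<lambda>\<omega>. \<omega> t)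
        = distr walk_space (measure_pmf step_pmf) (\<lambda>\<omega>. \<omega> t)"
      by (intro distr_cong) auto
    also have "\<dots> = measure_pmf step_pmf"
      unfolding walk_space_def by (rule distr_PiM_component) (auto intro: prob_space_measure_pmf)
    finally show ?thesis .
  qed
  have "distr walk_space (\<Pi>\<^sub>M _\<in>UNIV. count_space UNIV) (\<lambda>x. \<lambda>i\<in>UNIV. x i)
      = (\<Pi>\<^sub>M i\<in>UNIV. distr walk_space (count_space UNIV) (\<lambda>\<omega>. \<omega> i))"
    unfolding distr by (simp add: restrict_UNIV distr_id2 sets_walk_space flip: walk_space_def)
  then have "indep_vars (\<lambda>_. count_space UNIV) (\<lambda>t \<omega>. \<omega> t) UNIV"
    by (subst indep_vars_iff_distr_eq_PiM) (auto intro: measurable_step)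
  then show ?thesis
    unfolding simple_random_walk_def incr
    by (auto simp: distr measurable_walk prob_space_walk_space walk_def)
qed

theorem simple_random_walk_prob_exit_time:
  fixes X :: "nat \<Rightarrow> 'a \<Rightarrow> int ^ 'd"
  assumes "simple_random_walk M X"
  shows "measure M {\<omega> \<in> space M. exit_time X H \<omega> > enat t}
       = measure walk_space {\<omega> \<in> space walk_space. exit_time walk H \<omega> > enat t}"
proof -
  interpret prob_space M using assms by (simp add: simple_random_walk_def)
  define D where "D = (\<lambda>\<omega> s. X (Suc s) \<omega> - X s \<omega>)"
  let ?P = "\<Pi>\<^sub>M _\<in>(UNIV :: nat set). count_space (UNIV :: (int ^ 'd) set)"
  let ?B = "{\<omega> \<in> space walk_space. exit_time walk H \<omega> > enat t}"
  have X: "X s \<in> M \<rightarrow>\<^sub>M count_space UNIV" for s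
    using assms by (simp add: simple_random_walk_def)
  have Ds: "(\<lambda>\<omega>. D \<omega> s) \<in> M \<rightarrow>\<^sub>M count_space UNIV" for s
    unfolding D_def by (intro measurable_vec_diff X)
  have D: "D \<in> M \<rightarrow>\<^sub>M ?P"
    by (rule measurable_PiM_single') (use Ds in auto)
  have "distr M ?P (\<lambda>\<omega>. \<lambda>s\<in>UNIV. D \<omega> s) = (\<Pi>\<^sub>M s\<in>UNIV. distr M (count_space UNIV) (\<lambda>\<omega>. D \<omega> s))"
    by (rule indep_vars_iff_distr_eq_PiM[THEN iffD1])
      (use assms Ds in \<open>auto simp: simple_random_walk_def D_def\<close>)
  also have "\<dots> = walk_space"
    unfolding walk_space_def using assms by (simp add: simple_random_walk_def D_def)
  finally have distr: "distr M ?P D = walk_space"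
    by (simp add: restrict_UNIV)
  have B: "?B \<in> sets ?P"
    using sets_exit_time_gt[OF measurable_walk] by (simp add: sets_walk_space)
  have "measure walk_space ?B = measure (distr M ?P D) ?B"
    by (simp only: distr)
  also have "\<dots> = measure M (D -` ?B \<inter> space M)"
    by (rule measure_distr[OF D B])
  also have "\<dots> = measure M {\<omega> \<in> space M. exit_time X H \<omega> > enat t}"
  proof (rule finite_measure_eq_AE)
    have "AE \<omega> in M. X 0 \<omega> = 0"
      using assms by (simp add: simple_random_walk_def)
    then show "AE \<omega> in M. (\<omega> \<in> D -` ?B \<inter> space M)
        = (\<omega> \<in> {\<omega> \<in> space M. exit_time X H \<omega> > enat t})"
    proof (rule AE_mp, intro AE_I2 impI)
      fix \<omega> assume "\<omega> \<in> space M" "X 0 \<omega> = 0"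
      moreover have "walk s (D \<omega>) = X s \<omega>" for s
        using sum_lessThan_telescope[of "\<lambda>s. X s \<omega>" s] \<open>X 0 \<omega> = 0\<close> by (simp add: walk_def D_def)
      ultimately show "(\<omega> \<in> D -` ?B \<inter> space M)
        = (\<omega> \<in> {\<omega> \<in> space M. exit_time X H \<omega> > enat t})"
        by (simp add: exit_time_gt_iff space_walk_space)
    qed
    show "D -` ?B \<inter> space M \<in> events"
      by (rule measurable_sets[OF D B])
    show "{\<omega> \<in> space M. exit_time X H \<omega> > enat t} \<in> events"
      by (rule sets_exit_time_gt[OF X])
  qed
  finally show ?thesis ..
qed

end

theory Submission
  imports Defs
begin

text \<open>
  The survival probability is \<open>(P\<^sub>H\<^sup>t 1\<^sub>H)(0) \<le> \<parallel>P\<^sub>H\<^sup>t 1\<^sub>H\<parallel>\<close>, where \<open>P\<^sub>H\<close> is the walk's transition operator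
  killed outside \<open>H\<close>, so it suffices that \<open>P\<^sub>H\<close> contracts the \<open>\<ell>\<^sup>2\<close> norm by \<open>exp (- c n\<^sup>-\<^sup>2\<^sup>/\<^sup>d)\<close>. Applying
  Cauchy-Schwarz to the average over neighbours gives
  \<open>\<parallel>P\<^sub>H f\<parallel>\<^sup>2 \<le> \<parallel>f\<parallel>\<^sup>2 - (1/4d) \<Sum>\<^sub>i \<parallel>f(\<cdot> + 2e\<^sub>i) - f\<parallel>\<^sup>2\<close>; working with the square of \<open>P\<^sub>H\<close> avoids the
  parity problem of an eigenvalue near \<open>-1\<close>. If \<open>r\<^sup>d \<ge> 2n\<close>, the correlations \<open>\<langle>f, f(\<cdot> + v)\<rangle>\<close> summed over
  \<open>v \<in> 2{0,\<dots>,r-1}\<^sup>d\<close> are at most \<open>\<parallel>f\<parallel>\<^sub>1\<^sup>2 \<le> n \<parallel>f\<parallel>\<^sup>2\<close>, hence some such \<open>v\<close> has \<open>\<parallel>f(\<cdot> + v) - f\<parallel> \<ge> \<parallel>f\<parallel>\<close>, and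
  the triangle inequality along the coordinate directions bounds \<open>\<parallel>f\<parallel>\<close> by
  \<open>r \<Sum>\<^sub>i \<parallel>f(\<cdot> + 2e\<^sub>i) - f\<parallel>\<close>. Take \<open>r\<close> of order \<open>n\<^sup>1\<^sup>/\<^sup>d\<close>.
\<close>

section \<open>The \<open>\<ell>\<^sup>2\<close> norm of finitely supported functions\<close>

text \<open>Summing over the support lets \<open>f\<close> and its translates be compared without a
  fixed common carrier. On an infinite support the value defaults to 0.\<close>

definition l2 :: "('a \<Rightarrow> real) \<Rightarrow> real" where
  "l2 f = L2_set f {x. f x \<noteq> 0}"

lemma l2_eq_L2_set:
  assumes "finite S" "{x. f x \<noteq> 0} \<subseteq> S"
  shows "l2 f = L2_set f S"
proof -
  have "(\<Sum>x\<in>{x. f x \<noteq> 0}. (f x)\<^sup>2) = (\<Sum>x\<in>S. (f x)\<^sup>2)"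
    by (intro sum.mono_neutral_left) (use assms in auto)
  then show ?thesis by (simp add: l2_def L2_set_def)
qed

lemma l2_nonneg: "l2 f \<ge> 0"
  by (simp add: l2_def)

lemma l2_squared:
  assumes "finite S" "{x. f x \<noteq> 0} \<subseteq> S"
  shows "(l2 f)\<^sup>2 = (\<Sum>x\<in>S. (f x)\<^sup>2)"
  by (simp add: l2_eq_L2_set[OF assms] L2_set_def sum_nonneg)

lemma l2_triangle_ineq:
  assumes "finite {x. f x \<noteq> 0}" "finite {x. g x \<noteq> 0}"
  shows "l2 (\<lambda>x. f x + g x) \<le> l2 f + l2 g"
proof -
  let ?S = "{x. f x \<noteq> 0} \<union> {x. g x \<noteq> 0}"
  have "l2 (\<lambda>x. f x + g x) = L2_set (\<lambda>x. f x + g x) ?S"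
    by (rule l2_eq_L2_set) (use assms in auto)
  also have "\<dots> \<le> L2_set f ?S + L2_set g ?S"
    by (rule L2_set_triangle_ineq)
  also have "L2_set f ?S = l2 f"
    by (rule l2_eq_L2_set[symmetric]) (use assms in auto)
  also have "L2_set g ?S = l2 g"
    by (rule l2_eq_L2_set[symmetric]) (use assms in auto)
  finally show ?thesis .
qed

lemma abs_le_l2:
  assumes "finite {x. f x \<noteq> 0}"
  shows "\<bar>f x\<bar> \<le> l2 f"
proof (rule power2_le_imp_le[OF _ l2_nonneg])
  have "(f x)\<^sup>2 \<le> (\<Sum>y\<in>insert x {x. f x \<noteq> 0}. (f y)\<^sup>2)"
    by (rule member_le_sum) (use assms in auto)
  also have "\<dots> = (l2 f)\<^sup>2"
    by (rule l2_squared[symmetric]) (use assms in auto)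
  finally show "\<bar>f x\<bar>\<^sup>2 \<le> (l2 f)\<^sup>2" by simp
qed

lemma finite_support_shift:
  fixes f :: "'a :: ab_group_add \<Rightarrow> real"
  assumes "finite {x. f x \<noteq> 0}"
  shows "finite {x. f (x + v) \<noteq> 0}"
proof -
  have "{x. f (x + v) \<noteq> 0} = (\<lambda>x. x - v) ` {x. f x \<noteq> 0}"
    by (force simp: image_iff)
  then show ?thesis using assms by simp
qed

lemma l2_shift:
  fixes f :: "'a :: ab_group_add \<Rightarrow> real"
  shows "l2 (\<lambda>x. f (x + v)) = l2 f"
proof -
  have "bij_betw (\<lambda>x. x + v) {x. f (x + v) \<noteq> 0} {x. f x \<noteq> 0}"
    by (rule bij_betwI[where g = "\<lambda>x. x - v"]) auto
  then have "(\<Sum>x\<in>{x. f (x + v) \<noteq> 0}. (f (x + v))\<^sup>2) = (\<Sum>x\<in>{x. f x \<noteq> 0}. (f x)\<^sup>2)"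
    by (rule sum.reindex_bij_betw)
  then show ?thesis by (simp add: l2_def L2_set_def)
qed

section \<open>Oscillation under translations\<close>

definition osc :: "('a :: ab_group_add \<Rightarrow> real) \<Rightarrow> 'a \<Rightarrow> real" where
  "osc f v = l2 (\<lambda>x. f (x + v) - f x)"

lemma osc_nonneg: "osc f v \<ge> 0"
  by (simp add: osc_def l2_nonneg)

lemma osc_0 [simp]: "osc f 0 = 0"
  by (simp add: osc_def l2_def)

lemma finite_support_osc:
  fixes f :: "'a :: ab_group_add \<Rightarrow> real"
  assumes "finite {x. f x \<noteq> 0}"
  shows "finite {x. f (x + v) - f x \<noteq> 0}"
  by (rule finite_subset[OF _ finite_UnI[OF finite_support_shift[OF assms, of v] assms]]) auto

text \<open>The difference along \<open>v + w\<close> splits into the \<open>v\<close>-difference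
  translated by \<open>w\<close> plus the \<open>w\<close>-difference, and translations preserve the
  norm.\<close>

lemma osc_add:
  assumes "finite {x. f x \<noteq> 0}"
  shows "osc f (v + w) \<le> osc f v + osc f w"
proof -
  let ?g = "\<lambda>x. f (x + v) - f x"
  have "osc f (v + w) = l2 (\<lambda>x. ?g (x + w) + (f (x + w) - f x))"
    by (simp add: osc_def algebra_simps)
  also have "\<dots> \<le> l2 (\<lambda>x. ?g (x + w)) + l2 (\<lambda>x. f (x + w) - f x)"
    by (intro l2_triangle_ineq finite_support_shift[of ?g] finite_support_osc assms)
  also have "\<dots> = osc f v + osc f w"
    unfolding l2_shift[of ?g] by (simp add: osc_def)
  finally show ?thesis .
qed

text \<open>The spacing is 2 because averaging over neighbours controls increments between the two
  opposite neighbours of a point.\<close>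

lemma osc_axis:
  fixes f :: "int ^ 'd \<Rightarrow> real"
  assumes "finite {x. f x \<noteq> 0}"
  shows "osc f (axis i (2 * int k)) \<le> real k * osc f (axis i 2)"
proof (induction k)
  case 0
  then show ?case by (simp add: axis_def zero_vec_def[symmetric])
next
  case (Suc k)
  have "axis i (2 * int (Suc k)) = axis i (2 * int k) + axis i 2"
    by (simp add: vec_eq_iff axis_def)
  then show ?case
    using osc_add[OF assms, of "axis i (2 * int k)" "axis i 2"] Suc by (simp add: algebra_simps)
qed

lemma osc_sum_axis:
  fixes f :: "int ^ 'd \<Rightarrow> real"
  assumes "finite {x. f x \<noteq> 0}" "finite I"
  shows "osc f (\<Sum>i\<in>I. axis i (2 * int (y i))) \<le> (\<Sum>i\<in>I. real (y i) * osc f (axis i 2))"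
  using assms(2)
proof (induction I)
  case (insert j I)
  have "osc f (\<Sum>i\<in>insert j I. axis i (2 * int (y i)))
      \<le> osc f (axis j (2 * int (y j))) + osc f (\<Sum>i\<in>I. axis i (2 * int (y i)))"
    using insert osc_add[OF assms(1)] by simp
  then show ?case
    using insert osc_axis[OF assms(1), of j "y j"] by simp
qed simp

text \<open>Expanding the square gives two norms that agree by translation invariance. The cross
  term vanishes outside \<open>H\<close>.\<close>

lemma osc_squared:
  fixes f :: "'a :: ab_group_add \<Rightarrow> real"
  assumes "finite H" "{x. f x \<noteq> 0} \<subseteq> H"
  shows "(osc f v)\<^sup>2 = 2 * (l2 f)\<^sup>2 - 2 * (\<Sum>x\<in>H. f x * f (x + v))"
proof -
  have fin: "finite {x. f x \<noteq> 0}" using assms finite_subset by blast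
  let ?S = "H \<union> {x. f (x + v) \<noteq> 0}"
  have S: "finite ?S" using assms finite_support_shift[OF fin] by auto
  have "(osc f v)\<^sup>2 = (\<Sum>x\<in>?S. (f (x + v) - f x)\<^sup>2)"
    unfolding osc_def by (rule l2_squared) (use S assms in auto)
  also have "\<dots> = (\<Sum>x\<in>?S. (f (x + v))\<^sup>2) + (\<Sum>x\<in>?S. (f x)\<^sup>2) - 2 * (\<Sum>x\<in>?S. f x * f (x + v))"
    by (simp add: power2_diff sum.distrib sum_subtractf sum_distrib_left algebra_simps)
  also have "(\<Sum>x\<in>?S. (f (x + v))\<^sup>2) = (l2 (\<lambda>x. f (x + v)))\<^sup>2"
    by (rule l2_squared[symmetric]) (use S in auto)
  also have "\<dots> = (l2 f)\<^sup>2" by (simp only: l2_shift)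
  also have "(\<Sum>x\<in>?S. (f x)\<^sup>2) = (l2 f)\<^sup>2"
    by (rule l2_squared[symmetric]) (use S assms in auto)
  also have "(\<Sum>x\<in>?S. f x * f (x + v)) = (\<Sum>x\<in>H. f x * f (x + v))"
    by (rule sum.mono_neutral_right) (use S assms in auto)
  finally show ?thesis by simp
qed

text \<open>For fixed \<open>x\<close> the points \<open>x + v\<close> are distinct, so the inner
  sum is at most the total mass of \<bar>f\<bar>. The double sum is thus bounded by the square of
  that mass, and Cauchy-Schwarz on \<open>H\<close> finishes.\<close>

lemma sum_autocorrelation_le:
  fixes f :: "'a :: ab_group_add \<Rightarrow> real"
  assumes "finite H" "{x. f x \<noteq> 0} \<subseteq> H" "finite V"
  shows "(\<Sum>v\<in>V. \<Sum>x\<in>H. f x * f (x + v)) \<le> real (card H) * (l2 f)\<^sup>2"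
proof -
  have inner: "(\<Sum>v\<in>V. \<bar>f (x + v)\<bar>) \<le> (\<Sum>z\<in>H. \<bar>f z\<bar>)" for x
  proof -
    have "(\<Sum>v\<in>V. \<bar>f (x + v)\<bar>) = (\<Sum>z\<in>(\<lambda>v. x + v) ` V. \<bar>f z\<bar>)"
      by (subst sum.reindex) (auto simp: inj_on_def)
    also have "\<dots> \<le> (\<Sum>z\<in>((\<lambda>v. x + v) ` V) \<union> H. \<bar>f z\<bar>)"
      by (rule sum_mono2) (use assms in auto)
    also have "\<dots> = (\<Sum>z\<in>H. \<bar>f z\<bar>)"
      by (rule sum.mono_neutral_right) (use assms in auto)
    finally show ?thesis .
  qed
  have "(\<Sum>v\<in>V. \<Sum>x\<in>H. f x * f (x + v)) \<le> (\<Sum>v\<in>V. \<Sum>x\<in>H. \<bar>f x\<bar> * \<bar>f (x + v)\<bar>)"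
    by (intro sum_mono) (simp flip: abs_mult)
  also have "\<dots> = (\<Sum>x\<in>H. \<bar>f x\<bar> * (\<Sum>v\<in>V. \<bar>f (x + v)\<bar>))"
    by (subst sum.swap) (simp add: sum_distrib_left)
  also have "\<dots> \<le> (\<Sum>x\<in>H. \<bar>f x\<bar> * (\<Sum>z\<in>H. \<bar>f z\<bar>))"
    by (intro sum_mono mult_left_mono inner) auto
  also have "\<dots> = (\<Sum>x\<in>H. \<bar>f x\<bar>)\<^sup>2"
    by (simp add: power2_eq_square sum_distrib_right)
  also have "\<dots> \<le> real (card H) * (\<Sum>x\<in>H. \<bar>f x\<bar>\<^sup>2)"
    using sum_squared_le_sum_of_squares[of "\<lambda>x. \<bar>f x\<bar>" H] assms by (simp add: mult.commute)
  also have "(\<Sum>x\<in>H. \<bar>f x\<bar>\<^sup>2) = (l2 f)\<^sup>2"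
    using l2_squared[OF assms(1,2)] by simp
  finally show ?thesis .
qed

text \<open>If every oscillation were smaller, summing \<open>osc_squared\<close> over
  \<open>V\<close> would make twice the total correlation exceed \<open>card V\<close> times the
  squared norm, against \<open>sum_autocorrelation_le\<close>.\<close>

lemma exists_large_osc:
  fixes f :: "'a :: ab_group_add \<Rightarrow> real"
  assumes "finite H" "{x. f x \<noteq> 0} \<subseteq> H" "finite V" "V \<noteq> {}" "2 * card H \<le> card V"
  shows "\<exists>v\<in>V. l2 f \<le> osc f v"
proof (rule ccontr)
  assume "\<not> ?thesis"
  then have "(osc f v)\<^sup>2 < (l2 f)\<^sup>2" if "v \<in> V" for v
    using that osc_nonneg[of f v] by (auto simp: not_le intro!: power_strict_mono)
  then have "(\<Sum>v\<in>V. (osc f v)\<^sup>2) < (\<Sum>v\<in>V. (l2 f)\<^sup>2)"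
    using assms by (intro sum_strict_mono) auto
  then have "2 * real (card V) * (l2 f)\<^sup>2 - 2 * (\<Sum>v\<in>V. \<Sum>x\<in>H. f x * f (x + v)) < real (card V) * (l2 f)\<^sup>2"
    by (simp add: osc_squared[OF assms(1,2)] sum_subtractf sum_distrib_left)
  moreover have "2 * (real (card H) * (l2 f)\<^sup>2) \<le> real (card V) * (l2 f)\<^sup>2"
    using mult_right_mono[of "real (2 * card H)" "real (card V)" "(l2 f)\<^sup>2"] assms(5) by simp
  ultimately show False
    using sum_autocorrelation_le[OF assms(1-3)] by linarith
qed

text \<open>A Poincare inequality: a translation with large oscillation is found in a box, then
  decomposed along the axes with fewer than \<open>r\<close> double steps in each.\<close>

lemma l2_le_sum_osc_axis:
  fixes f :: "int ^ 'd \<Rightarrow> real"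
  assumes "finite H" "{x. f x \<noteq> 0} \<subseteq> H" "2 * card H \<le> r ^ CARD('d)" "r \<ge> 1"
  shows "l2 f \<le> real r * (\<Sum>i\<in>UNIV. osc f (axis i 2))"
proof -
  let ?B = "PiE (UNIV :: 'd set) (\<lambda>_. {..<r})"
  let ?w = "\<lambda>y. \<Sum>i\<in>(UNIV :: 'd set). axis i (2 * int (y i))"
  have fin: "finite {x. f x \<noteq> 0}" using assms finite_subset by blast
  have w: "?w y $ j = 2 * int (y j)" for y j
    by (simp add: axis_def)
  \<comment> \<open>Each coordinate of \<open>?w y\<close> recovers the corresponding
    \<open>y j\<close>, so the box really offers \<open>r ^ CARD('d)\<close> translations.\<close>
  have inj: "inj_on ?w ?B"
    by (rule inj_onI, rule ext) (metis w mult_left_cancel of_nat_eq_iff zero_neq_numeral)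
  have "finite ?B" by (simp add: finite_PiE)
  moreover have "card (?w ` ?B) = r ^ CARD('d)"
    by (simp add: card_image[OF inj] card_PiE)
  moreover have "?w ` ?B \<noteq> {}"
    using \<open>r \<ge> 1\<close> by (auto simp: PiE_eq_empty_iff lessThan_empty_iff)
  ultimately obtain y where y: "y \<in> ?B" "l2 f \<le> osc f (?w y)"
    using exists_large_osc[OF assms(1,2), of "?w ` ?B"] assms(3) by auto
  note y(2)
  also have "osc f (?w y) \<le> (\<Sum>i\<in>UNIV. real (y i) * osc f (axis i 2))"
    by (rule osc_sum_axis[OF fin]) simp
  also have "\<dots> \<le> (\<Sum>i\<in>UNIV. real r * osc f (axis i 2))"
    by (intro sum_mono mult_right_mono osc_nonneg)
      (use y in \<open>auto simp: PiE_def Pi_def less_imp_le\<close>)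
  finally show ?thesis by (simp add: sum_distrib_left)
qed

section \<open>Contraction of the killed transition operator\<close>

definition killed_step :: "(int ^ 'd) set \<Rightarrow> (int ^ 'd \<Rightarrow> real) \<Rightarrow> int ^ 'd \<Rightarrow> real" where
  "killed_step H f x = indicator H x * ((\<Sum>e\<in>unit_steps. f (x + e)) / (2 * real CARD('d)))"

lemma support_killed_step: "{x. killed_step H f x \<noteq> 0} \<subseteq> H"
  by (auto simp: killed_step_def indicator_def)

lemma sum_unit_steps:
  fixes g :: "int ^ 'd \<Rightarrow> real"
  shows "(\<Sum>e\<in>unit_steps. g e) = (\<Sum>i\<in>UNIV. g (axis i 1) + g (axis i (- 1)))"
proof -
  have ne: "axis i (1 :: int) \<noteq> axis i (- 1)" for i :: 'd
    by (simp add: axis_eq_axis)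
  have "(\<Sum>e\<in>unit_steps. g e) = (\<Sum>i\<in>UNIV. \<Sum>e\<in>{axis i 1, axis i (- 1)}. g e)"
    unfolding unit_steps_def by (rule sum.UNION_disjoint) (auto simp: axis_eq_axis)
  then show ?thesis using ne by simp
qed

text \<open>Cauchy-Schwarz is applied across the coordinates only. Within each opposite pair the
  parallelogram identity is exact and retains the deficit
  \<open>(a i - b i)\<^sup>2\<close>.\<close>

lemma square_average_le:
  fixes a b :: "'d :: finite \<Rightarrow> real"
  shows "((\<Sum>i\<in>UNIV. a i + b i) / (2 * real CARD('d)))\<^sup>2
    \<le> (\<Sum>i\<in>UNIV. 2 * (a i)\<^sup>2 + 2 * (b i)\<^sup>2 - (a i - b i)\<^sup>2) / (4 * real CARD('d))"
proof -
  have "(\<Sum>i\<in>UNIV. a i + b i)\<^sup>2 \<le> real CARD('d) * (\<Sum>i\<in>UNIV. (a i + b i)\<^sup>2)"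
    using sum_squared_le_sum_of_squares[of "\<lambda>i. a i + b i" UNIV] by (simp add: mult.commute)
  also have "(\<Sum>i\<in>UNIV. (a i + b i)\<^sup>2) = (\<Sum>i\<in>UNIV. 2 * (a i)\<^sup>2 + 2 * (b i)\<^sup>2 - (a i - b i)\<^sup>2)"
    by (intro sum.cong refl) (simp add: power2_eq_square algebra_simps)
  finally have "(\<Sum>i\<in>UNIV. a i + b i)\<^sup>2 / (4 * (real CARD('d))\<^sup>2)
      \<le> real CARD('d) * (\<Sum>i\<in>UNIV. 2 * (a i)\<^sup>2 + 2 * (b i)\<^sup>2 - (a i - b i)\<^sup>2) / (4 * (real CARD('d))\<^sup>2)"
    by (rule divide_right_mono) simp
  also have "\<dots> = (\<Sum>i\<in>UNIV. 2 * (a i)\<^sup>2 + 2 * (b i)\<^sup>2 - (a i - b i)\<^sup>2) / (4 * real CARD('d))"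
    by (simp add: power2_eq_square)
  finally show ?thesis by (simp add: power_divide power_mult_distrib)
qed

lemma l2_killed_step_le:
  fixes f :: "int ^ 'd \<Rightarrow> real"
  assumes "finite H" "{x. f x \<noteq> 0} \<subseteq> H"
  shows "(l2 (killed_step H f))\<^sup>2
    \<le> (l2 f)\<^sup>2 - (\<Sum>i\<in>UNIV. (osc f (axis i 2))\<^sup>2) / (4 * real CARD('d))"
proof -
  define d where "d = real CARD('d)"
  have d: "d > 0" by (simp add: d_def)
  have fin: "finite {x. f x \<noteq> 0}" using assms finite_subset by blast
  \<comment> \<open>One finite set carrying \<open>f\<close>, its neighbour shifts and the result,
    so that all sums share an index set.\<close>
  define S where "S = H \<union> (\<Union>e\<in>unit_steps. {x. f (x + e) \<noteq> 0})"
  have S: "finite S"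
    unfolding S_def by (intro finite_UnI finite_UN_I assms finite_unit_steps finite_support_shift fin)
  have sub: "{x. f (x + axis i 1) \<noteq> 0} \<subseteq> S" "{x. f (x + axis i (- 1)) \<noteq> 0} \<subseteq> S" for i
    unfolding S_def by (auto simp: unit_steps_def)
  have osc: "(\<Sum>x\<in>S. (f (x + axis i 1) - f (x + axis i (- 1)))\<^sup>2) = (osc f (axis i 2))\<^sup>2" for i
  proof -
    have "(\<Sum>x\<in>S. (f (x + axis i 1) - f (x + axis i (- 1)))\<^sup>2)
        = (l2 (\<lambda>x. f (x + axis i 1) - f (x + axis i (- 1))))\<^sup>2"
      by (rule l2_squared[symmetric, OF S]) (rule order_trans[OF _ Un_least[OF sub[of i]]], auto)
    also have "l2 (\<lambda>x. f (x + axis i 1) - f (x + axis i (- 1))) = osc f (axis i 2)"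
    proof -
      \<comment> \<open>Recentring at \<open>x + axis i (- 1)\<close> turns the difference across
        \<open>x\<close> into a translation by \<open>axis i 2\<close>.\<close>
      have "x + axis i 1 = x + axis i (- 1) + axis i 2" for x :: "int ^ 'd"
        by (simp add: vec_eq_iff axis_def)
      then show ?thesis
        using l2_shift[of "\<lambda>x. f (x + axis i 2) - f x" "axis i (- 1)"] by (simp only: osc_def)
    qed
    finally show ?thesis .
  qed
  have shifted: "(\<Sum>x\<in>S. (f (x + axis i c))\<^sup>2) = (l2 f)\<^sup>2" if "c = 1 \<or> c = - 1" for i c
    using l2_squared[OF S, of "\<lambda>x. f (x + axis i c)"] sub[of i] that by (auto simp: l2_shift)
  have "(l2 (killed_step H f))\<^sup>2 = (\<Sum>x\<in>S. (killed_step H f x)\<^sup>2)"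
    by (rule l2_squared[OF S]) (use support_killed_step[of H f] in \<open>auto simp: S_def\<close>)
  \<comment> \<open>Forgetting the killing outside \<open>H\<close> can only increase the sum of
    squares.\<close>
  also have "\<dots> \<le> (\<Sum>x\<in>S. ((\<Sum>e\<in>unit_steps. f (x + e)) / (2 * d))\<^sup>2)"
    by (intro sum_mono) (auto simp: killed_step_def indicator_def d_def)
  also have "\<dots> \<le> (\<Sum>x\<in>S. (\<Sum>i\<in>UNIV. 2 * (f (x + axis i 1))\<^sup>2 + 2 * (f (x + axis i (- 1)))\<^sup>2
      - (f (x + axis i 1) - f (x + axis i (- 1)))\<^sup>2) / (4 * d))"
    unfolding sum_unit_steps d_def by (intro sum_mono square_average_le)
  also have "\<dots> = (\<Sum>i\<in>UNIV. \<Sum>x\<in>S. 2 * (f (x + axis i 1))\<^sup>2 + 2 * (f (x + axis i (- 1)))\<^sup>2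
      - (f (x + axis i 1) - f (x + axis i (- 1)))\<^sup>2) / (4 * d)"
    by (subst sum.swap) (simp only: sum_divide_distrib)
  also have "\<dots> = (\<Sum>i\<in>(UNIV :: 'd set). 4 * (l2 f)\<^sup>2 - (osc f (axis i 2))\<^sup>2) / (4 * d)"
    by (simp add: sum.distrib sum_subtractf osc shifted flip: sum_distrib_left)
  also have "\<dots> = (l2 f)\<^sup>2 - (\<Sum>i\<in>UNIV. (osc f (axis i 2))\<^sup>2) / (4 * d)"
    using d by (simp add: sum_subtractf diff_divide_distrib d_def)
  finally show ?thesis by (simp only: d_def)
qed

lemma l2_killed_step_contraction:
  fixes f :: "int ^ 'd \<Rightarrow> real"
  assumes "finite H" "{x. f x \<noteq> 0} \<subseteq> H" "2 * card H \<le> r ^ CARD('d)" "r \<ge> 1"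
  shows "l2 (killed_step H f) \<le> exp (- 1 / (8 * (real CARD('d))\<^sup>2 * (real r)\<^sup>2)) * l2 f"
proof -
  define d where "d = real CARD('d)"
  define s where "s = (\<Sum>i\<in>(UNIV :: 'd set). (osc f (axis i 2))\<^sup>2)"
  \<comment> \<open>Relative loss of the squared norm: \<open>4 * d\<close> from the averaging
    deficit, a further \<open>d\<close> from Cauchy-Schwarz over the axes, and the squared side
    length. Taking roots halves the exponent, whence the 8.\<close>
  define q where "q = 1 / (4 * d\<^sup>2 * (real r)\<^sup>2)"
  have d: "d > 0" by (simp add: d_def)
  have "(l2 f)\<^sup>2 \<le> (real r * (\<Sum>i\<in>(UNIV :: 'd set). osc f (axis i 2)))\<^sup>2"
    by (intro power_mono l2_le_sum_osc_axis[OF assms] l2_nonneg)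
  also have "\<dots> \<le> (real r)\<^sup>2 * (s * d)"
    unfolding power_mult_distrib s_def d_def
    by (intro mult_left_mono sum_squared_le_sum_of_squares) auto
  finally have "q * (l2 f)\<^sup>2 \<le> q * ((real r)\<^sup>2 * (s * d))"
    by (intro mult_left_mono) (auto simp: q_def)
  also have "\<dots> = s / (4 * d)"
    using d \<open>r \<ge> 1\<close> by (simp add: q_def field_simps power2_eq_square)
  finally have "(l2 (killed_step H f))\<^sup>2 \<le> (1 - q) * (l2 f)\<^sup>2"
    using l2_killed_step_le[OF assms(1,2)] by (simp add: algebra_simps d_def s_def)
  also have "\<dots> \<le> exp (- q) * (l2 f)\<^sup>2"
    using exp_ge_add_one_self[of "- q"] by (intro mult_right_mono) auto
  also have "\<dots> = (exp (- q / 2) * l2 f)\<^sup>2"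
    by (simp add: power_mult_distrib flip: exp_double)
  finally have "l2 (killed_step H f) \<le> exp (- q / 2) * l2 f"
    by (rule power2_le_imp_le) (simp add: l2_nonneg)
  then show ?thesis by (simp add: q_def d_def mult.assoc)
qed

section \<open>Survival probabilities\<close>

definition survival :: "(int ^ 'd) set \<Rightarrow> nat \<Rightarrow> int ^ 'd \<Rightarrow> real" where
  "survival H t = (killed_step H ^^ t) (indicator H)"

lemma support_survival: "{x. survival H t x \<noteq> 0} \<subseteq> H"
proof (cases t)
  case 0
  then show ?thesis by (auto simp: survival_def indicator_def)
next
  case (Suc s)
  then show ?thesis using support_killed_step[of H "survival H s"] by (simp add: survival_def)
qed

lemma survival_nonneg: "survival H t x \<ge> 0"
proof (induction t arbitrary: x)
  case (Suc t)
  have "survival H (Suc t) x = killed_step H (survival H t) x"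
    by (simp add: survival_def)
  then show ?case
    by (auto simp: killed_step_def intro!: divide_nonneg_nonneg sum_nonneg Suc mult_nonneg_nonneg)
qed (simp add: survival_def)

lemma walk_Suc_case_nat: "walk (Suc s) (case_nat e \<omega>) = e + walk s \<omega>"
  by (simp add: walk_def sum.lessThan_Suc_shift del: sum.lessThan_Suc)

lemma sets_walk_stays: "{\<omega>. \<forall>s\<le>t. x + walk s \<omega> \<in> H} \<in> sets walk_space"
proof -
  have "(\<lambda>\<omega>. x + walk s \<omega>) \<in> walk_space \<rightarrow>\<^sub>M count_space UNIV" for s
    by (rule measurable_compose[OF measurable_walk]) simp
  from sets_exit_time_gt[of "\<lambda>s \<omega>. x + walk s \<omega>", OF this, of t H]
  show ?thesis by (simp add: exit_time_gt_iff space_walk_space)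
qed

text \<open>First-step analysis: after the first step the walk starts afresh from a neighbour, so
  the induction must range over all starting points \<open>x\<close>.\<close>

lemma emeasure_walk_stays:
  fixes H :: "(int ^ 'd) set"
  shows "emeasure walk_space {\<omega>. \<forall>s\<le>t. x + walk s \<omega> \<in> H} = ennreal (survival H t x)"
proof (induction t arbitrary: x)
  case 0
  interpret prob_space "walk_space :: (nat \<Rightarrow> int ^ 'd) measure" by (rule prob_space_walk_space)
  have "{\<omega>. \<forall>s\<le>0. x + walk s \<omega> \<in> H} = (if x \<in> H then space walk_space else {})"
    by (auto simp: walk_def space_walk_space)
  then show ?case
    using emeasure_space_1 by (simp add: survival_def)
next
  case (Suc t)
  let ?M = "measure_pmf (step_pmf :: (int ^ 'd) pmf)"
  let ?E = "{\<omega>. \<forall>s\<le>Suc t. x + walk s \<omega> \<in> H}"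
  let ?f = "\<lambda>(e, \<omega>). case_nat e \<omega> :: nat \<Rightarrow> int ^ 'd"
  interpret sequence_space ?M ..
  have eq: "walk_space = (\<Pi>\<^sub>M i\<in>UNIV. ?M)" by (simp add: walk_space_def)
  interpret W: prob_space "walk_space :: (nat \<Rightarrow> int ^ 'd) measure" by (rule prob_space_walk_space)
  have meas: "?f \<in> ?M \<Otimes>\<^sub>M walk_space \<rightarrow>\<^sub>M walk_space"
    unfolding eq by measurable
  have stays_Suc: "case_nat e \<omega> \<in> ?E \<longleftrightarrow> x \<in> H \<and> (\<forall>s\<le>t. (x + e) + walk s \<omega> \<in> H)" for e \<omega>
  proof -
    have "case_nat e \<omega> \<in> ?E \<longleftrightarrow> x + walk 0 (case_nat e \<omega>) \<in> H
        \<and> (\<forall>s\<le>t. x + walk (Suc s) (case_nat e \<omega>) \<in> H)"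
      using All_less_Suc2[of "Suc t" "\<lambda>s. x + walk s (case_nat e \<omega>) \<in> H"]
      by (simp add: less_Suc_eq_le)
    then show ?thesis by (simp only: walk_Suc_case_nat) (simp add: walk_def add.assoc)
  qed
  \<comment> \<open>Prepending an independent step to a sequence of steps reproduces the law of the
    sequence.\<close>
  have "emeasure walk_space ?E = emeasure (distr (?M \<Otimes>\<^sub>M walk_space) walk_space ?f) ?E"
    unfolding eq by (simp only: PiM_iter)
  also have "\<dots> = emeasure (?M \<Otimes>\<^sub>M walk_space) (?f -` ?E \<inter> space (?M \<Otimes>\<^sub>M walk_space))"
    using meas sets_walk_stays by (rule emeasure_distr)
  also have "\<dots> = (\<integral>\<^sup>+e. emeasure walk_space
      (Pair e -` (?f -` ?E \<inter> space (?M \<Otimes>\<^sub>M walk_space))) \<partial>?M)"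
    by (rule W.emeasure_pair_measure_alt, rule measurable_sets[OF meas sets_walk_stays])
  also have "\<dots> = (\<integral>\<^sup>+e. ennreal (indicator H x * survival H t (x + e)) \<partial>?M)"
  proof (rule nn_integral_cong)
    fix e
    have "Pair e -` (?f -` ?E \<inter> space (?M \<Otimes>\<^sub>M walk_space))
        = (if x \<in> H then {\<omega>. \<forall>s\<le>t. (x + e) + walk s \<omega> \<in> H} else {})"
      using stays_Suc by (auto simp: space_pair_measure space_walk_space simp del: mem_Collect_eq)
    then show "emeasure walk_space (Pair e -` (?f -` ?E \<inter> space (?M \<Otimes>\<^sub>M walk_space)))
        = ennreal (indicator H x * survival H t (x + e))"
      using Suc.IH[of "x + e"] by simp
  qed
  also have "\<dots> = ennreal (\<Sum>e\<in>unit_steps. indicator H x * survival H t (x + e)) / card (unit_steps :: (int ^ 'd) set)"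
    unfolding step_pmf_def
    by (subst nn_integral_pmf_of_set)
      (auto simp: finite_unit_steps unit_steps_nonempty survival_nonneg intro!: sum_ennreal)
  also have "of_nat (card (unit_steps :: (int ^ 'd) set)) = ennreal (2 * real CARD('d))"
    unfolding card_unit_steps ennreal_of_nat_eq_real_of_nat by simp
  also have "ennreal (\<Sum>e\<in>unit_steps. indicator H x * survival H t (x + e)) / ennreal (2 * real CARD('d))
      = ennreal ((\<Sum>e\<in>unit_steps. indicator H x * survival H t (x + e)) / (2 * real CARD('d)))"
    by (intro divide_ennreal sum_nonneg) (auto simp: survival_nonneg)
  also have "\<dots> = ennreal (survival H (Suc t) x)"
    by (simp add: survival_def[of H "Suc t"] killed_step_def sum_distrib_left flip: survival_def)
  finally show ?case .
qed

lemma prob_exit_time_gt: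
  "measure walk_space {\<omega> \<in> space walk_space. exit_time walk H \<omega> > enat t} = survival H t 0"
  using emeasure_walk_stays[of t 0 H]
  by (simp add: measure_def exit_time_gt_iff space_walk_space survival_nonneg)

text \<open>Iterates the contraction from the indicator of \<open>H\<close>, whose norm is the
  source of the square root in the final bound.\<close>

lemma l2_survival_le:
  fixes H :: "(int ^ 'd) set"
  assumes "finite H" "2 * card H \<le> r ^ CARD('d)" "r \<ge> 1"
  shows "l2 (survival H t) \<le> exp (- real t / (8 * (real CARD('d))\<^sup>2 * (real r)\<^sup>2)) * sqrt (card H)"
proof (induction t)
  case 0
  have "(l2 (indicator H :: _ \<Rightarrow> real))\<^sup>2 = card H"
    using l2_squared[OF \<open>finite H\<close>, of "indicator H"] by (simp add: indicator_def)
  then have "l2 (indicator H :: _ \<Rightarrow> real) = sqrt (card H)"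
    by (metis real_sqrt_unique l2_nonneg)
  then show ?case by (simp add: survival_def)
next
  case (Suc t)
  define q where "q = 8 * (real CARD('d))\<^sup>2 * (real r)\<^sup>2"
  have "l2 (survival H (Suc t)) = l2 (killed_step H (survival H t))"
    by (simp add: survival_def)
  also have "\<dots> \<le> exp (- 1 / q) * l2 (survival H t)"
    unfolding q_def by (rule l2_killed_step_contraction[OF assms(1) support_survival assms(2,3)])
  also have "\<dots> \<le> exp (- 1 / q) * (exp (- real t / q) * sqrt (card H))"
    using Suc by (simp add: q_def)
  also have "\<dots> = exp (- real (Suc t) / q) * sqrt (card H)"
    by (simp add: mult.assoc[symmetric] add_divide_distrib diff_divide_distrib flip: exp_add)
  finally show ?case by (simp add: q_def)
qed

section \<open>Choice of the box side and the final estimate\<close>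

lemma exists_side_length:
  assumes "n \<ge> 1" "d \<ge> 1"
  shows "\<exists>r\<ge>1. 2 * n \<le> r ^ d \<and> (real r)\<^sup>2 \<le> 16 * real n powr (2 / real d)"
proof -
  define a where "a = (2 * real n) powr (1 / real d)"
  have a: "a \<ge> 1" unfolding a_def by (rule ge_one_powr_ge_zero) (use assms in auto)
  \<comment> \<open>Since \<open>a\<close> is at least 1, rounding up at most doubles it; with
    \<open>2 powr (1 / real d)\<close> at most 2 this gives the factor 4, squared to 16.\<close>
  define r where "r = nat \<lceil>a\<rceil>"
  have r: "a \<le> real r" "real r \<le> a + 1" using a unfolding r_def by linarith+
  have "a ^ d = 2 * real n"
    unfolding a_def using assms by (simp add: powr_powr flip: powr_realpow)
  then have "real (2 * n) \<le> real r ^ d"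
    using power_mono[OF r(1), of d] a by simp
  then have "2 * n \<le> r ^ d"
    by (metis of_nat_le_iff of_nat_power)
  moreover have "a \<le> 2 * real n powr (1 / real d)"
  proof -
    have "2 powr (1 / real d) \<le> 2 powr (1 :: real)"
      using assms by (intro powr_mono) auto
    then show ?thesis by (simp add: a_def powr_mult mult_right_mono)
  qed
  then have "real r \<le> 4 * real n powr (1 / real d)"
    using r a by linarith
  then have "(real r)\<^sup>2 \<le> (4 * real n powr (1 / real d))\<^sup>2"
    by (intro power_mono) auto
  then have "(real r)\<^sup>2 \<le> 16 * real n powr (2 / real d)"
    by (simp add: power_mult_distrib power2_eq_square flip: powr_add)
  moreover have "r \<ge> 1" using r a by linarith
  ultimately show ?thesis by auto
qed

theorem proposition2p3:
  shows "\<exists>c::real. c > 0 \<and>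
    (\<forall>(t::nat) (n::nat) (H :: (int ^ 'd) set).
       t \<ge> 1 \<longrightarrow> n \<ge> 1 \<longrightarrow> finite H \<longrightarrow> card H = n \<longrightarrow>
       measure walk_space {\<omega> \<in> space walk_space. exit_time walk H \<omega> > enat t}
         \<le> sqrt (real n) * exp (- c * real t * real n powr (- 2 / real CARD('d))))"
proof -
  define d where "d = real CARD('d)"
  \<comment> \<open>Here 128 is 8 from the contraction rate times 16 from the bound on the squared
    side.\<close>
  define c where "c = 1 / (128 * d\<^sup>2)"
  have d: "d > 0" by (simp add: d_def)
  have "measure walk_space {\<omega> \<in> space walk_space. exit_time walk H \<omega> > enat t}
      \<le> sqrt (real n) * exp (- c * real t * real n powr (- 2 / d))"
    if n: "n \<ge> 1" and H: "finite H" "card H = n" for t n and H :: "(int ^ 'd) set"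
  proof -
    obtain r where r: "r \<ge> 1" "2 * n \<le> r ^ CARD('d)" "(real r)\<^sup>2 \<le> 16 * real n powr (2 / d)"
      using exists_side_length[OF n, of "CARD('d)"] by (auto simp: d_def Suc_le_eq)
    have "c * real t * real n powr (- 2 / d) = real t / (8 * d\<^sup>2 * (16 * real n powr (2 / d)))"
      by (simp add: c_def powr_minus_divide)
    also have "\<dots> \<le> real t / (8 * d\<^sup>2 * (real r)\<^sup>2)"
      using r d n by (intro divide_left_mono mult_left_mono mult_pos_pos) auto
    finally have le: "c * real t * real n powr (- 2 / d) \<le> real t / (8 * d\<^sup>2 * (real r)\<^sup>2)" .
    have "survival H t 0 \<le> l2 (survival H t)"
      using abs_le_l2[OF finite_subset[OF support_survival H(1)], of t 0] by linarith
    also have "\<dots> \<le> exp (- real t / (8 * d\<^sup>2 * (real r)\<^sup>2)) * sqrt (real n)"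
      unfolding d_def using l2_survival_le[OF H(1) _ r(1), of t] r(2) H(2) by simp
    also have "\<dots> \<le> exp (- c * real t * real n powr (- 2 / d)) * sqrt (real n)"
      using le by (intro mult_right_mono) auto
    finally show ?thesis by (simp add: prob_exit_time_gt mult.commute)
  qed
  moreover have "c > 0" using d by (simp add: c_def)
  ultimately show ?thesis unfolding d_def by blast
qed

end
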